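(* Let $L\subseteq\mathbb R^*$ be a language that is decided either (a) by a deterministic S-BSS machine, or (b) by a $[0,1]$-nondeterministic S-BSS machine in time $t$, for some function $t:\mathbb N\to\mathbb N$. Then $L$ is a countable disjoint union of sets each of which is a closed subset of $\mathbb R^n$ (for some $n$) in the usual topology of $\mathbb R^n$.
   Context: $\mathbb R^*=\bigcup_n\mathbb R^n$ and $|x|=n$ for $x\in\mathbb R^n$. An S-BSS machine has state space the bi-infinite real sequences $(x_i)_{i\in\mathbb Z}$ and a finite directed graph with nodes $1,\dots,N$: node $1$ is the input node, node $N$ the output node; computation nodes set one coordinate $x_i$ to $x_j+x_k$, $x_j-x_k$, $x_j\cdot x_k$, or a real machine constant $c$ (others unchanged); shift nodes shift the sequence left ($x\mapsto(x_{i+1})_i$) or right; separate branch nodes carry reals $\epsilon_-<\epsilon_+$ and go to one successor if $x_0\ge\epsilon_+$, to another if $x_0\le\epsilon_-$, and otherwise reject the input. Each node visit is one step. The input $(x_1,\dots,x_n)$ is placed with $n$ at coordinate $0$, $x_1,\dots,x_n$ at coordinates $1,\dots,n$, zeros elsewhere; on reaching node $N$ the output is $(x_1,\dots,x_l)$ where $l$ is the number of consecutive ones in coordinates $-1,-2,\dots$. A deterministic machine decides $L$ if it computes the characteristic function of $L$. A $[0,1]$-nondeterministic machine is run on an input $x$ together with a guess $x'\in[0,1]^*$ (initial state: $|x|$ at coordinate 0, $|x'|$ at coordinate 1, then the entries of $x$ and then of $x'$); it decides $L$ if $x\in L$ iff some guess $x'\in[0,1]^*$ leads to output $1$, and does so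 in time $t$ if every $x\in L$ yields output $1$ within $t(|x|)$ steps for some guess.
   Formalization: In (b), as the claim fails otherwise, two clauses are added: each x in L has an accepting guess x' of length at most t(|x|) leading to output 1 within t(|x|) steps, and for every input and every guess any output reached is 0 or 1. Rejection counts as output 0. *)

theory Defs
  imports "HOL-Analysis.Analysis" "HOL-Library.More_List" "HOL-Library.Disjoint_Sets"
begin

type_synonym state = "int \<Rightarrow> real"

text \<open>The arguments of type \<^typ>\<open>nat\<close> are the successor nodes. In a branch node
  \<open>Branch e d p q\<close> the thresholds are \<open>\<epsilon>\<^sub>- = e\<close> and \<open>\<epsilon>\<^sub>+ = d\<close>; \<open>p\<close> is the
  successor for \<open>x\<^sub>0 \<le> \<epsilon>\<^sub>-\<close> and \<open>q\<close> the one for \<open>x\<^sub>0 \<ge> \<epsilon>\<^sub>+\<close>.\<close>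

datatype node =
    Input nat
  | Output
  | Add int int int nat
  | Sub int int int nat
  | Mul int int int nat
  | Const int real nat
  | Shift_Left nat
  | Shift_Right nat
  | Branch real real nat nat

fun successors :: "node \<Rightarrow> nat set" where
  "successors (Input p) = {p}"
| "successors Output = {}"
| "successors (Add i j k p) = {p}"
| "successors (Sub i j k p) = {p}"
| "successors (Mul i j k p) = {p}"
| "successors (Const i c p) = {p}"
| "successors (Shift_Left p) = {p}"
| "successors (Shift_Right p) = {p}"
| "successors (Branch e d p q) = {p, q}"

datatype machine = Machine (num_nodes: nat) (node: "nat \<Rightarrow> node")

definition S_BSS :: "machine \<Rightarrow> bool" where
  "S_BSS M \<longleftrightarrow>
     1 < num_nodes M \<and>
     (\<forall>m\<in>{1..num_nodes M}.
        ((\<exists>p. node M m = Input p) \<longleftrightarrow> m = 1) \<and>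
        (node M m = Output \<longleftrightarrow> m = num_nodes M) \<and>
        successors (node M m) \<subseteq> {1..num_nodes M} \<and>
        (\<forall>e d p q. node M m = Branch e d p q \<longrightarrow> e < d))"

text \<open>\<^term>\<open>None\<close> means that the input has been rejected. The output node is made
  absorbing, so that a run is an infinite sequence.\<close>

fun exec :: "node \<Rightarrow> nat \<times> state \<Rightarrow> (nat \<times> state) option" where
  "exec (Input p) (m, x) = Some (p, x)"
| "exec Output (m, x) = Some (m, x)"
| "exec (Add i j k p) (m, x) = Some (p, x(i := x j + x k))"
| "exec (Sub i j k p) (m, x) = Some (p, x(i := x j - x k))"
| "exec (Mul i j k p) (m, x) = Some (p, x(i := x j * x k))"
| "exec (Const i c p) (m, x) = Some (p, x(i := c))"
| "exec (Shift_Left p) (m, x) = Some (p, \<lambda>i. x (i + 1))"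
| "exec (Shift_Right p) (m, x) = Some (p, \<lambda>i. x (i - 1))"
| "exec (Branch e d p q) (m, x) =
     (if x 0 \<ge> d then Some (q, x) else if x 0 \<le> e then Some (p, x) else None)"

fun run :: "machine \<Rightarrow> state \<Rightarrow> nat \<Rightarrow> (nat \<times> state) option" where
  "run M s 0 = Some (1, s)"
| "run M s (Suc k) = Option.bind (run M s k) (\<lambda>c. exec (node M (fst c)) c)"

text \<open>The \<open>LEAST\<close> is the number of consecutive ones in the coordinates \<open>-1, -2, \<dots>\<close>;
  reachable states have finite support, so it always exists there.\<close>

definition output_map :: "state \<Rightarrow> real list" where
  "output_map x = map (\<lambda>i. x (1 + int i)) [0..<(LEAST l. x (- 1 - int l) \<noteq> 1)]"

text \<open>Rejecting an input amounts to the answer \<open>0\<close>. The bound \<open>T\<close> counts node visits,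
  those of the input and the output node included.\<close>

definition yields_within :: "machine \<Rightarrow> state \<Rightarrow> nat \<Rightarrow> real list \<Rightarrow> bool" where
  "yields_within M s T y \<longleftrightarrow>
     (\<exists>k<T. (\<exists>x. run M s k = Some (num_nodes M, x) \<and> y = output_map x) \<or>
            (run M s k = None \<and> y = [0]))"

definition yields :: "machine \<Rightarrow> state \<Rightarrow> real list \<Rightarrow> bool" where
  "yields M s y \<longleftrightarrow> (\<exists>T. yields_within M s T y)"

definition place :: "real list \<Rightarrow> state" where
  "place ys = (\<lambda>i. if i < 0 then 0 else nth_default 0 ys (nat i))"

definition det_input :: "real list \<Rightarrow> state" where
  "det_input x = place (real (length x) # x)"

definition nondet_input :: "real list \<Rightarrow> real list \<Rightarrow> state" where
  "nondet_input x g = place (real (length x) # real (length g) # x @ g)"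

definition det_decides :: "machine \<Rightarrow> real list set \<Rightarrow> bool" where
  "det_decides M L \<longleftrightarrow> (\<forall>x. yields M (det_input x) [indicator L x])"

abbreviation guesses :: "real list set" where
  "guesses \<equiv> lists {0..1}"

text \<open>Like a characteristic function, a nondeterministic decision procedure has no outputs
  other than \<open>0\<close> and \<open>1\<close>. Without this, the set \<open>{x. x \<noteq> 1}\<close> in dimension 1 would be
  decided in constant time by setting \<open>x\<^sub>-\<^sub>2\<close> to the input and \<open>x\<^sub>-\<^sub>1\<close>, \<open>x\<^sub>1\<close> to \<open>1\<close>, since
  the length of the output is read off by an exact comparison with \<open>1\<close>. That set is not a
  countable disjoint union of closed sets.\<close>

definition nondet_decides :: "machine \<Rightarrow> real list set \<Rightarrow> bool" where
  "nondet_decides M L \<longleftrightarrow>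
     (\<forall>x. \<forall>g\<in>guesses. \<forall>y. yields M (nondet_input x g) y \<longrightarrow> y = [0] \<or> y = [1]) \<and>
     (\<forall>x. x \<in> L \<longleftrightarrow> (\<exists>g\<in>guesses. yields M (nondet_input x g) [1]))"

text \<open>The time bound also limits the length of the accepting guess, as is usual for
  nondeterministic time. Otherwise the number \<open>|x'|\<close>, which is part of the initial state,
  would provide an unbounded discrete guess at no cost: comparing \<open>|x'| * x\<^sub>1\<close> with
  \<open>0\<close> and \<open>1\<close> would decide \<open>{x. x\<^sub>1 > 0}\<close> in constant time, which in dimension 1 is not
  a countable disjoint union of closed sets.\<close>

definition nondet_decides_in_time ::
    "machine \<Rightarrow> (nat \<Rightarrow> nat) \<Rightarrow> real list set \<Rightarrow> bool" where
  "nondet_decides_in_time M t L \<longleftrightarrow>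
     nondet_decides M L \<and>
     (\<forall>x\<in>L. \<exists>g\<in>guesses. length g \<le> t (length x) \<and>
        yields_within M (nondet_input x g) (t (length x)) [1])"

text \<open>\<^const>\<open>Euclidean_space\<close> \<open>n\<close> is the library's \<open>\<real>\<^sup>n\<close> with \<open>n\<close> a term: its points are the
  sequences that vanish from index \<open>n\<close> on.\<close>

definition closed_dim :: "nat \<Rightarrow> real list set \<Rightarrow> bool" where
  "closed_dim n A \<longleftrightarrow>
     A \<subseteq> {x. length x = n} \<and> closedin (Euclidean_space n) (nth_default 0 ` A)"

end

theory Submission
  imports Defs
begin

text \<open>Since a branch node either rejects or tests one of two closed conditions, the states from
  which a machine arrives at a given node after \<open>k\<close> steps with its contents in a given closed set
  form a closed set. So do those that reach the output node at step \<open>k\<close> for the first time: the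
  step before then visits one of the finitely many other nodes. As all outputs have length one,
  acceptance is the closed condition \<open>x\<^sub>1 = 1\<close> on the halting state. In the deterministic case these
  closed sets, sorted by input length and halting time, are the required pieces. In the
  nondeterministic case the halting times and guess lengths are bounded for each input length, and
  a projection along the compact cube of guesses is closed, so all inputs of one length that are
  accepted form a single closed set.\<close>

section \<open>Closed preimages under a single machine step\<close>

lemma continuous_on_fun_upd:
  fixes f :: "('a \<Rightarrow> real) \<Rightarrow> real"
  assumes "continuous_on UNIV f"
  shows "continuous_on UNIV (\<lambda>x. x(i := f x))"
proof (rule continuous_on_coordinatewise_then_product)
  fix j
  show "continuous_on UNIV (\<lambda>x. (x(i := f x)) j)"
    using assms by (cases "j = i") simp_all
qed

lemma continuous_on_reindex:
  "continuous_on UNIV (\<lambda>(x::'b \<Rightarrow> real) i. x (r i))"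
  by (intro continuous_on_coordinatewise_then_product continuous_on_product_coordinates)

text \<open>Every node other than a branch has one successor and acts by a map that is continuous in
  the product topology, so the set is empty or the preimage of \<open>C\<close> under that
  map.\<close>

lemma closed_exec:
  assumes C: "closed C" and branch: "\<And>e d p q. v = Branch e d p q \<Longrightarrow> e < d"
  shows "closed {x. \<exists>y\<in>C. exec v (m, x) = Some (m', y)}"
proof -
  have pre: "closed {x. p = m' \<and> f x \<in> C}" if "continuous_on UNIV f" for p and f :: "state \<Rightarrow> state"
    using closed_vimage[OF C that] by (cases "p = m'") (auto simp: vimage_def)
  consider (step) p f where "continuous_on UNIV f" "\<And>x. exec v (m, x) = Some (p, f x)"
    | (branch) e d p q where "v = Branch e d p q"
  proof (cases v)
    case Input
    then show ?thesis using step[of "\<lambda>x. x"] by simp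
  next
    case Output
    then show ?thesis using step[of "\<lambda>x. x"] by simp
  next
    case (Add i j k p)
    have "continuous_on UNIV (\<lambda>x::state. x(i := x j + x k))"
      by (intro continuous_on_fun_upd continuous_on_add continuous_on_product_coordinates)
    from step[OF this, of p] show ?thesis using Add by simp
  next
    case (Sub i j k p)
    have "continuous_on UNIV (\<lambda>x::state. x(i := x j - x k))"
      by (intro continuous_on_fun_upd continuous_on_diff continuous_on_product_coordinates)
    from step[OF this, of p] show ?thesis using Sub by simp
  next
    case (Mul i j k p)
    have "continuous_on UNIV (\<lambda>x::state. x(i := x j * x k))"
      by (intro continuous_on_fun_upd continuous_on_mult continuous_on_product_coordinates)
    from step[OF this, of p] show ?thesis using Mul by simp
  next
    case (Const i c p)
    have "continuous_on UNIV (\<lambda>x::state. x(i := c))"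
      by (intro continuous_on_fun_upd continuous_on_const)
    from step[OF this, of p] show ?thesis using Const by simp
  next
    case (Shift_Left p)
    from step[OF continuous_on_reindex, of p] show ?thesis using Shift_Left by simp
  next
    case (Shift_Right p)
    from step[OF continuous_on_reindex, of p] show ?thesis using Shift_Right by simp
  next
    case Branch
    then show ?thesis by (rule that(2))
  qed
  then show ?thesis
  proof cases
    case step
    have "{x. \<exists>y\<in>C. exec v (m, x) = Some (m', y)} = {x. p = m' \<and> f x \<in> C}"
      by (auto simp: step(2))
    then show ?thesis using pre[OF step(1)] by simp
  next
    case (branch e d p q)
    have id: "continuous_on UNIV (\<lambda>x::state. x)"
      by (rule continuous_on_id)
    have "closed {x::state. d \<le> x 0}" "closed {x::state. x 0 \<le> e}"
      by (intro closed_Collect_le continuous_on_const continuous_on_product_coordinates)+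
    \<comment> \<open>As \<open>e < d\<close>, the test against \<open>e\<close> succeeds only where
      the test against \<open>d\<close> fails. The negation of the first test, an open condition,
      thus disappears.\<close>
    then have "closed (({x. q = m' \<and> x \<in> C} \<inter> {x. d \<le> x 0}) \<union> ({x. p = m' \<and> x \<in> C} \<inter> {x. x 0 \<le> e}))"
      by (intro closed_Un closed_Int pre[OF id])
    also have "\<dots> = {x. \<exists>y\<in>C. exec v (m, x) = Some (m', y)}"
      using assms(2)[OF branch] branch by (auto split: if_splits)
    finally show ?thesis .
  qed
qed

section \<open>Closed sets of initial states\<close>

definition reach :: "machine \<Rightarrow> nat \<Rightarrow> nat \<Rightarrow> state set \<Rightarrow> state set" where
  "reach M k m C = {s. \<exists>x\<in>C. run M s k = Some (m, x)}"

lemma exec_successors: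
  "exec v (m, x) = Some (m', y) \<Longrightarrow> m' \<in> successors v \<or> v = Output \<and> m' = m"
  by (cases v) (auto split: if_splits)

lemma run_node:
  assumes "S_BSS M" "run M s k = Some (m, x)"
  shows "m \<in> {1..num_nodes M}"
  using assms(2)
proof (induction k arbitrary: m x)
  case 0
  then show ?case using assms(1) by (auto simp: S_BSS_def)
next
  case (Suc k)
  then obtain m' x' where *: "run M s k = Some (m', x')" "exec (node M m') (m', x') = Some (m, x)"
    by (auto simp: bind_eq_Some_conv)
  with Suc.IH have "m' \<in> {1..num_nodes M}" by blast
  with exec_successors[OF *(2)] show ?case
    using assms(1) unfolding S_BSS_def by blast
qed

lemma reach_Suc:
  assumes "S_BSS M"
  shows "reach M (Suc k) m' C =
    (\<Union>m\<in>{1..num_nodes M}. reach M k m {x. \<exists>y\<in>C. exec (node M m) (m, x) = Some (m', y)})"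
  using run_node[OF assms] by (force simp: reach_def bind_eq_Some_conv)

lemma closed_exec_node:
  assumes "S_BSS M" "m \<in> {1..num_nodes M}" "closed C"
  shows "closed {x. \<exists>y\<in>C. exec (node M m) (m, x) = Some (m', y)}"
  using assms by (intro closed_exec) (auto simp: S_BSS_def)

text \<open>The last step is peeled off: the condition \<open>C\<close> on the state after it
  becomes another closed condition on the state before it, so \<open>C\<close> must vary in the
  induction. The union over the preceding nodes is finite.\<close>

lemma closed_reach:
  assumes "S_BSS M" "closed C"
  shows "closed (reach M k m C)"
  using assms(2)
proof (induction k arbitrary: m C)
  case 0
  then show ?case by (cases "m = 1") (auto simp: reach_def)
next
  case (Suc k)
  show ?case
    unfolding reach_Suc[OF assms(1)]
    by (intro closed_UN ballI Suc.IH closed_exec_node[OF assms(1)] Suc.prems) auto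
qed

text \<open>With an absorbing output node the sets \<open>reach M k (num_nodes M) C\<close> grow
  with \<open>k\<close>. Subtracting the earlier arrivals makes them disjoint; index
  \<open>k\<close> stands for arrival at step \<open>Suc k\<close>.\<close>

definition first_output :: "machine \<Rightarrow> nat \<Rightarrow> state set \<Rightarrow> state set" where
  "first_output M k C = reach M (Suc k) (num_nodes M) C - reach M k (num_nodes M) UNIV"

text \<open>A difference of closed sets need not be closed, but here the subtraction only deletes
  the term of the output node from the finite union in \<open>reach_Suc\<close>.\<close>

lemma closed_first_output:
  assumes "S_BSS M" "closed C"
  shows "closed (first_output M k C)"
proof -
  let ?N = "num_nodes M"
  have "first_output M k C =
    (\<Union>m\<in>{1..?N} - {?N}. reach M k m {x. \<exists>y\<in>C. exec (node M m) (m, x) = Some (?N, y)})"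
    unfolding first_output_def reach_Suc[OF assms(1)] by (auto simp: reach_def)
  also have "closed \<dots>"
    by (intro closed_UN ballI closed_reach closed_exec_node assms) auto
  finally show ?thesis .
qed

section \<open>Halting, rejection and the answer one\<close>

lemma run_output_mono:
  assumes "S_BSS M" "run M s k = Some (num_nodes M, x)" "k \<le> l"
  shows "run M s l = Some (num_nodes M, x)"
  using assms(3,2)
proof (induction l rule: dec_induct)
  case (step l)
  have "node M (num_nodes M) = Output"
    using assms(1) by (auto simp: S_BSS_def)
  with step show ?case by simp
qed

lemma run_None_mono:
  assumes "run M s k = None" "k \<le> l"
  shows "run M s l = None"
  using assms(2,1) by (induction l rule: dec_induct) auto

text \<open>Halting and rejection both persist, so two answers can be compared at one common late
  step.\<close>

lemma yields_unique:
  assumes "S_BSS M" "yields M s y" "yields M s y'"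
  shows "y = y'"
proof -
  have *: "\<exists>k. \<forall>l\<ge>k. (\<exists>x. run M s l = Some (num_nodes M, x) \<and> y = output_map x) \<or>
      (run M s l = None \<and> y = [0])" if "yields M s y" for y
    using that run_output_mono[OF assms(1)] run_None_mono
    unfolding yields_def yields_within_def by metis
  obtain k l where
    k: "\<And>i. i \<ge> k \<Longrightarrow> (\<exists>x. run M s i = Some (num_nodes M, x) \<and> y = output_map x) \<or>
      (run M s i = None \<and> y = [0])" and
    l: "\<And>i. i \<ge> l \<Longrightarrow> (\<exists>x. run M s i = Some (num_nodes M, x) \<and> y' = output_map x) \<or>
      (run M s i = None \<and> y' = [0])"
    using *[OF assms(2)] *[OF assms(3)] by blast
  show ?thesis
    using k[of "max k l"] l[of "max k l"] by auto
qed

lemma yields_output: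
  "run M s k = Some (num_nodes M, x) \<Longrightarrow> yields M s (output_map x)"
  by (auto simp: yields_def yields_within_def)

lemma output_map_singleton:
  assumes "length (output_map x) = 1"
  shows "output_map x = [x 1]"
  using assms by (simp add: output_map_def)

text \<open>The length of an output is found by a test for being different from one, which is not a
  closed condition. Knowing in advance that the length is one leaves only the equation for
  coordinate \<open>1\<close>. A rejection gives \<open>[0]\<close> and contributes nothing.\<close>

lemma yields_within_one_iff:
  assumes "\<And>y. yields M s y \<Longrightarrow> length y = 1"
  shows "yields_within M s T [1] \<longleftrightarrow> (\<exists>k<T. s \<in> reach M k (num_nodes M) {x. x 1 = 1})"
proof -
  have "output_map x = [x 1]" if "run M s k = Some (num_nodes M, x)" for k x
    using assms yields_output[OF that] output_map_singleton by blast
  then show ?thesis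
    unfolding yields_within_def reach_def by fastforce
qed

lemma yields_one_iff:
  assumes "\<And>y. yields M s y \<Longrightarrow> length y = 1"
  shows "yields M s [1] \<longleftrightarrow> (\<exists>k. s \<in> reach M k (num_nodes M) {x. x 1 = 1})"
proof -
  have "yields_within M s T [1] \<longleftrightarrow> (\<exists>k<T. s \<in> reach M k (num_nodes M) {x. x 1 = 1})" for T
    using assms by (rule yields_within_one_iff)
  then show ?thesis
    by (auto simp: yields_def)
qed

lemma closed_first_coord: "closed {x::state. x 1 = 1}"
  by (intro closed_Collect_eq continuous_on_const continuous_on_product_coordinates)

lemma reach_imp_first_output:
  assumes "S_BSS M" "s \<in> reach M k (num_nodes M) C"
  shows "\<exists>j. s \<in> first_output M j C"
proof -
  let ?P = "\<lambda>j. s \<in> reach M j (num_nodes M) UNIV"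
  from assms(2) obtain x where x: "run M s k = Some (num_nodes M, x)" "x \<in> C"
    by (auto simp: reach_def)
  then have "?P k" by (auto simp: reach_def)
  \<comment> \<open>Step 0 visits node 1, which is not the output node, so the first arrival happens
    at some \<open>Suc j\<close>.\<close>
  moreover have "\<not> ?P 0" using assms(1) by (auto simp: reach_def S_BSS_def)
  ultimately obtain j where j: "j < k" "\<not> ?P j" "?P (Suc j)"
    using ex_least_nat_less[of ?P k] by blast
  from j(3) obtain y where y: "run M s (Suc j) = Some (num_nodes M, y)"
    by (auto simp: reach_def)
  \<comment> \<open>The output node leaves the state unchanged, so \<open>C\<close> already holds at
    the first arrival.\<close>
  have "y = x"
    using run_output_mono[OF assms(1) y, of k] j(1) x(1) by simp
  with j(2) x(2) y have "s \<in> first_output M j C"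
    unfolding first_output_def by (auto simp: reach_def simp del: run.simps)
  then show ?thesis ..
qed

lemma first_output_unique:
  assumes "S_BSS M" "s \<in> first_output M i C" "s \<in> first_output M j C"
  shows "i = j"
proof -
  have *: "\<not> i < j" if "s \<in> first_output M i C" "s \<in> first_output M j C" for i j
    using that run_output_mono[OF assms(1), of s "Suc i" _ j]
    by (auto simp: first_output_def reach_def simp del: run.simps)
  show ?thesis
    using *[OF assms(2,3)] *[OF assms(3,2)] by simp
qed

section \<open>Lists as points of Euclidean space\<close>

lemma nth_default_map_upt:
  assumes "\<And>i. i \<ge> n \<Longrightarrow> v i = 0"
  shows "nth_default 0 (map v [0..<n]) = v"
  using assms by (auto simp: nth_default_def)

text \<open>Padding with zeros identifies the lists of length \<open>n\<close> with the points of
  \<open>Euclidean_space n\<close>, which carries the subspace topology of the sequence space.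
  Closedness may therefore be proved among all sequences.\<close>

lemma closed_dim_vimage:
  assumes "closed S"
  shows "closed_dim n {x. length x = n \<and> nth_default 0 x \<in> S}"
proof -
  have "nth_default 0 ` {x. length x = n \<and> nth_default 0 x \<in> S} = topspace (Euclidean_space n) \<inter> S"
    (is "?l = ?r")
  proof
    show "?l \<subseteq> ?r" by (auto simp: topspace_Euclidean_space nth_default_beyond)
    show "?r \<subseteq> ?l"
    proof
      fix v assume "v \<in> ?r"
      then show "v \<in> ?l"
        using nth_default_map_upt[of n v]
        by (intro image_eqI[of _ _ "map v [0..<n]"]) (auto simp: topspace_Euclidean_space)
    qed
  qed
  moreover have "closedin (Euclidean_space n) (topspace (Euclidean_space n) \<inter> S)"
    using assms unfolding topspace_Euclidean_space unfolding Euclidean_space_def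
    by (intro closedin_subtopology_Int_closedin) (auto simp: euclidean_product_topology)
  ultimately show ?thesis
    by (auto simp: closed_dim_def)
qed

section \<open>Initial states as continuous functions\<close>

definition det_state :: "nat \<Rightarrow> (nat \<Rightarrow> real) \<Rightarrow> state" where
  "det_state n v = (\<lambda>i. if i < 0 then 0 else if i = 0 then real n else v (nat i - 1))"

lemma det_input_eq: "det_input x = det_state (length x) (nth_default 0 x)"
proof
  fix i
  show "det_input x i = det_state (length x) (nth_default 0 x) i"
    by (cases "nat i") (auto simp: det_input_def det_state_def place_def)
qed

lemma continuous_det_state: "continuous_on UNIV (det_state n)"
proof (rule continuous_on_coordinatewise_then_product)
  fix i
  show "continuous_on UNIV (\<lambda>v. det_state n v i)"
    unfolding det_state_def by (cases "i < 0"; cases "i = 0") simp_all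
qed

text \<open>Like \<open>det_state\<close>, this fixes the lengths and takes arbitrary sequences, so
  that continuity holds on \<open>UNIV\<close>; nothing is cut off, the zeros at the end come from
  \<open>nth_default\<close>. The pair keeps the guess separate, to be projected away.\<close>

definition nondet_state :: "nat \<Rightarrow> nat \<Rightarrow> (nat \<Rightarrow> real) \<times> (nat \<Rightarrow> real) \<Rightarrow> state" where
  "nondet_state n m = (\<lambda>(v, w) i. if i < 0 then 0 else if i = 0 then real n
     else if i = 1 then real m else if nat i - 2 < n then v (nat i - 2) else w (nat i - 2 - n))"

lemma nondet_input_eq:
  "nondet_input x g = nondet_state (length x) (length g) (nth_default 0 x, nth_default 0 g)"
proof
  fix i
  show "nondet_input x g i =
    nondet_state (length x) (length g) (nth_default 0 x, nth_default 0 g) i"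
  proof (cases "nat i")
    case 0
    then show ?thesis by (auto simp: nondet_input_def nondet_state_def place_def)
  next
    case (Suc j)
    then show ?thesis
      by (cases j) (auto simp: nondet_input_def nondet_state_def place_def nth_default_append
          nth_default_nth)
  qed
qed

lemma continuous_nondet_state: "continuous_on UNIV (nondet_state n m)"
proof -
  have "continuous_on UNIV (\<lambda>z::(nat \<Rightarrow> real) \<times> (nat \<Rightarrow> real). fst z j)"
    "continuous_on UNIV (\<lambda>z::(nat \<Rightarrow> real) \<times> (nat \<Rightarrow> real). snd z j)" for j
    by (rule continuous_on_compose2[OF continuous_on_product_coordinates[of j]],
        simp_all add: continuous_on_fst continuous_on_snd)+
  then have "continuous_on UNIV (\<lambda>z. nondet_state n m z i)" for i
    unfolding nondet_state_def case_prod_beta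
    by (cases "i < 0"; cases "i = 0"; cases "i = 1"; cases "nat i - 2 < n") simp_all
  then show ?thesis
    by (rule continuous_on_coordinatewise_then_product)
qed

section \<open>Compactness of the guesses of a fixed length\<close>

definition cube :: "nat \<Rightarrow> (nat \<Rightarrow> real) set" where
  "cube m = (\<Pi>\<^sub>E i\<in>UNIV. if i < m then {0..1} else {0})"

text \<open>This is Tychonoff's theorem; the factors \<open>{0}\<close> from index \<open>m\<close>
  on make the cube a product over all indices.\<close>

lemma compact_cube: "compact (cube m)"
proof -
  have "compactin (product_topology (\<lambda>i. euclidean) UNIV) (cube m)"
    unfolding cube_def by (subst compactin_PiE) auto
  then show ?thesis by (simp add: euclidean_product_topology)
qed

lemma cube_eq: "cube m = nth_default 0 ` {g \<in> guesses. length g = m}"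
proof
  show "nth_default 0 ` {g \<in> guesses. length g = m} \<subseteq> cube m"
    by (auto simp: cube_def nth_default_def in_lists_conv_set dest!: nth_mem)
  show "cube m \<subseteq> nth_default 0 ` {g \<in> guesses. length g = m}"
  proof
    fix w assume w: "w \<in> cube m"
    have w0: "w i \<in> (if i < m then {0..1} else {0})" for i
      using PiE_mem[OF w[unfolded cube_def], of i] by simp
    have "w i = 0" if "i \<ge> m" for i
      using w0[of i] that by simp
    moreover have "map w [0..<m] \<in> guesses"
    proof -
      have "w i \<in> {0..1}" if "i < m" for i
        using w0[of i] that by simp
      then show ?thesis by auto
    qed
    ultimately show "w \<in> nth_default 0 ` {g \<in> guesses. length g = m}"
      using nth_default_map_upt[of m w] by (intro image_eqI[of _ _ "map w [0..<m]"]) auto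
  qed
qed

text \<open>Projection along a compact space is a closed map. To apply this, \<open>K\<close> is
  taken as a space of its own, in whose product with the first factor the restricted
  \<open>D\<close> is closed.\<close>

lemma closed_fst_compact:
  fixes D :: "('a::topological_space \<times> 'b::topological_space) set"
  assumes "compact K" "closed D"
  shows "closed (fst ` (D \<inter> UNIV \<times> K))"
proof -
  have "closed_map (prod_topology euclidean (top_of_set K)) euclidean (fst :: 'a \<times> 'b \<Rightarrow> 'a)"
    using assms(1) by (intro closed_map_fst compact_space_subtopology) simp
  moreover have "closedin (prod_topology euclidean (top_of_set K)) (D \<inter> UNIV \<times> K)"
    using prod_topology_subtopology_eu[of "UNIV :: 'a set" K] closedin_closed_Int[OF assms(2), of "UNIV \<times> K"]
    by (simp add: Int_commute)
  ultimately show ?thesis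
    by (simp add: closed_map_def)
qed

section \<open>The two decompositions\<close>

lemma det_decides_pieces:
  assumes M: "S_BSS M" and L: "det_decides M L"
  shows "\<exists>F. countable F \<and> disjoint F \<and> \<Union>F = L \<and> (\<forall>A\<in>F. \<exists>n. closed_dim n A)"
proof -
  define A where "A = (\<lambda>(n, k). {x. length x = n \<and>
    nth_default 0 x \<in> det_state n -` first_output M k {s. s 1 = 1}})"
  have A: "x \<in> A (n, k) \<longleftrightarrow> length x = n \<and> det_input x \<in> first_output M k {s. s 1 = 1}" for x n k
    by (auto simp: A_def det_input_eq)
  \<comment> \<open>\<open>det_decides\<close> only asserts that the characteristic value is
    yielded; uniqueness excludes any other answer.\<close>
  have unique: "y = [indicator L x]" if "yields M (det_input x) y" for x y
    using yields_unique[OF M that] L by (simp add: det_decides_def)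
  have "x \<in> L \<longleftrightarrow> (\<exists>k. det_input x \<in> first_output M k {s. s 1 = 1})" for x
  proof -
    have "yields M (det_input x) [indicator L x]"
      using L by (simp only: det_decides_def)
    then have "x \<in> L \<longleftrightarrow> yields M (det_input x) [1]"
      using unique[of x "[1]"] by (cases "x \<in> L") auto
    also have "\<dots> \<longleftrightarrow> (\<exists>k. det_input x \<in> reach M k (num_nodes M) {s. s 1 = 1})"
      by (rule yields_one_iff) (drule unique, simp)
    also have "\<dots> \<longleftrightarrow> (\<exists>k. det_input x \<in> first_output M k {s. s 1 = 1})"
      using reach_imp_first_output[OF M] by (auto simp: first_output_def)
    finally show ?thesis .
  qed
  then have "\<Union>(range A) = L"
    by (auto simp: A)
  \<comment> \<open>The list determines \<open>n\<close>, and its time of first arrival determines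
    \<open>k\<close>.\<close>
  moreover have "disjoint_family A"
    using first_output_unique[OF M] by (force simp: disjoint_family_on_def A)
  moreover have "closed_dim n (A (n, k))" for n k
    unfolding A_def split
    by (intro closed_dim_vimage closed_vimage closed_first_output M closed_first_coord
        continuous_det_state)
  ultimately show ?thesis
    by (intro exI[of _ "range A"]) (auto intro: disjoint_family_on_disjoint_image)
qed

lemma nondet_decides_pieces:
  assumes M: "S_BSS M" and L: "nondet_decides_in_time M t L"
  shows "\<exists>F. countable F \<and> disjoint F \<and> \<Union>F = L \<and> (\<forall>A\<in>F. \<exists>n. closed_dim n A)"
proof -
  define P where "P = (\<lambda>n m k. fst ` (nondet_state n m -`
      reach M k (num_nodes M) {s. s 1 = 1} \<inter> UNIV \<times> cube m))"
  \<comment> \<open>Both unions are finite by the bound \<open>t n\<close>, hence preserve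
    closedness. They may overlap, since each length contributes a single piece.\<close>
  define A where "A = (\<lambda>n. {x. length x = n \<and> nth_default 0 x \<in> (\<Union>m\<le>t n. \<Union>k<t n. P n m k)})"
  have P: "nth_default 0 x \<in> P (length x) m k \<longleftrightarrow> (\<exists>g\<in>guesses. length g = m \<and>
      nondet_input x g \<in> reach M k (num_nodes M) {s. s 1 = 1})" for x m k
    by (force simp: P_def cube_eq nondet_input_eq)
  have length_1: "length y = 1" if "yields M (nondet_input x g) y" "g \<in> guesses" for x g y
  proof -
    have "y = [0] \<or> y = [1]"
      using L that unfolding nondet_decides_in_time_def nondet_decides_def by blast
    then show ?thesis by auto
  qed
  have within: "yields_within M (nondet_input x g) T [1] \<longleftrightarrow>
      (\<exists>k<T. nondet_input x g \<in> reach M k (num_nodes M) {s. s 1 = 1})" if "g \<in> guesses" for x g T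
    by (rule yields_within_one_iff) (rule length_1[OF _ that])
  \<comment> \<open>The time bound gives one direction; the other forgets the bounds and uses that
    acceptance by any guess implies membership.\<close>
  have "x \<in> L \<longleftrightarrow> (\<exists>g\<in>guesses. length g \<le> t (length x) \<and>
      yields_within M (nondet_input x g) (t (length x)) [1])" for x
    using L unfolding nondet_decides_in_time_def nondet_decides_def yields_def by blast
  then have "x \<in> L \<longleftrightarrow> x \<in> A (length x)" for x
    by (auto simp: A_def P within)
  then have "\<Union>(range A) = L"
    by (auto simp: A_def)
  moreover have "disjoint_family A"
    by (auto simp: disjoint_family_on_def A_def)
  moreover have "closed_dim n (A n)" for n
    unfolding A_def P_def
    by (intro closed_dim_vimage closed_UN ballI closed_fst_compact compact_cube closed_vimage
        closed_reach M closed_first_coord continuous_nondet_state) auto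
  ultimately show ?thesis
    by (intro exI[of _ "range A"]) (auto intro: disjoint_family_on_disjoint_image)
qed

theorem theorem4p1:
  fixes L :: "real list set"
  assumes "(\<exists>M. S_BSS M \<and> det_decides M L) \<or>
           (\<exists>M t. S_BSS M \<and> nondet_decides_in_time M t L)"
  shows "\<exists>F. countable F \<and> disjoint F \<and> \<Union>F = L \<and> (\<forall>A\<in>F. \<exists>n. closed_dim n A)"
  using assms by (elim disjE exE conjE) (rule det_decides_pieces nondet_decides_pieces; assumption)+

end
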